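(* Fix $\kappa\in\mathbb{R}$; if $\kappa\neq0$ let $k>0$ with $|\kappa|=4k^2$. Set $I=(0,\frac{\pi}{k})$ if $\kappa>0$ and $I=(0,\infty)$ otherwise. Let $G$ be the model space corresponding to $\kappa$ (as described in the context) with left-invariant orthonormal frame $(X_1,X_2)$ of the contact distribution, and consider the embedded surface $$S=\{\exp(r\cos\theta\,X_1+r\sin\theta\,X_2): r\in I,\ \theta\in[0,2\pi)\}.$$ Then in the coordinates $(r,\theta)$ the limiting operator $\Delta_0=\widehat{X}_S^2+b\,\widehat{X}_S$ on $S$ is $$\Delta_0=\frac{\partial^2}{\partial r^2}+b(r)\frac{\partial}{\partial r},\qquad b(r)=\begin{cases}2k\cot(kr)&\text{if }\kappa=4k^2,\\ \frac{2}{r}&\text{if }\kappa=0,\\ 2k\coth(kr)&\text{if }\kappa=-4k^2.\end{cases}$$ Consequently, the stochastic process induced by $\frac12\Delta_0$, moving along the leaves of the characteristic foliation of $S$ (the curves $\theta=\mathrm{const}$), is a Bessel process of order $3$ if $\kappa=0$, a Legendre process of order $3$ (on $(0,\pi/k)$) if $\kappa>0$, and a hyperbolic Bessel process of order $3$ if $\kappa<0$.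
   Context: General setting: for a three-dimensional contact sub-Riemannian manifold $(M,D,g)$ with contact form $\omega$ normalised by ${\mathrm d}\omega|_D=-\operatorname{vol}_g$, Reeb field $X_0$ (${\mathrm d}\omega(X_0,\cdot)=0$, $\omega(X_0)=1$), global oriented orthonormal frame $(X_1,X_2)$ of $D$, and a surface $S=\{u=0\}$ with $u\in C^2$, ${\mathrm d}u\ne0$ on $S$, the characteristic set is $\Gamma(S)=\{X_1u=X_2u=0\}$, and on $S\setminus\Gamma(S)$ one sets $\widehat{X}_S=\frac{(X_2u)X_1-(X_1u)X_2}{\sqrt{(X_1u)^2+(X_2u)^2}}$ and $b=\frac{X_0u}{\sqrt{(X_1u)^2+(X_2u)^2}}$ (these depend only on $S$, up to the choice of sign of $u$, and $\Delta_0$ does not depend on this choice). Model spaces: $G$ is a three-dimensional Lie group with contact sub-Riemannian structure whose distribution is spanned by left-invariant $g$-orthonormal vector fields $X_1,X_2$ with Reeb vector field $X_0$ satisfying $[X_1,X_2]=X_0$, $[X_0,X_1]=\kappa X_2$, $[X_0,X_2]=-\kappa X_1$. For $\kappa=0$: the Heisenberg group $\mathbb{R}^3$ with law $(x_1,y_1,z_1)*(x_2,y_2,z_2)=(x_1+x_2,y_1+y_2,z_1+z_2+\frac12(x_1y_2-x_2y_1))$, $X_1=\partial_x-\frac y2\partial_z$, $X_2=\partial_y+\frac x2\partial_z$. For $\kappa=4k^2$: ${\rm SU}(2)$ with $X_1,X_2$ the left-invariant vector fields corresponding to $k\,i\sigma_1$ and $k\,i\sigma_2$ ($\sigma_1,\sigma_2$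 Pauli matrices). For $\kappa=-4k^2$: ${\rm SL}(2,\mathbb{R})$ with $X_1,X_2$ the left-invariant vector fields corresponding to $k\begin{pmatrix}1&0\\0&-1\end{pmatrix}$ and $k\begin{pmatrix}0&1\\1&0\end{pmatrix}$. In each case $\exp$ is the group exponential, identifying a left-invariant vector field with its value at the identity. The Bessel process of order $3$, Legendre process of order $3$ and hyperbolic Bessel process of order $3$ are the diffusions with generators $\frac12\frac{d^2}{dr^2}+\frac1r\frac{d}{dr}$ on $(0,\infty)$, $\frac12\frac{d^2}{dr^2}+k\cot(kr)\frac{d}{dr}$ on $(0,\pi/k)$, and $\frac12\frac{d^2}{dr^2}+k\coth(kr)\frac{d}{dr}$ on $(0,\infty)$, respectively. *)

theory Defs
  imports "HOL-Analysis.Analysis"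
begin

section \<open>Generic Lie-group calculus on an ambient real normed vector space\<close>

text \<open>A group is given by its multiplication gmul (defined on the whole ambient
 space 'g) and its identity e; the Lie algebra is identified with the tangent
 space at e, i.e. with vectors of 'g.\<close>

definition one_param_subgroup ::
  "('g::real_normed_vector \<Rightarrow> 'g \<Rightarrow> 'g) \<Rightarrow> 'g \<Rightarrow> 'g \<Rightarrow> (real \<Rightarrow> 'g) \<Rightarrow> bool" where
  "one_param_subgroup gmul e A \<gamma> \<longleftrightarrow>
     \<gamma> 0 = e \<and> (\<forall>s t. \<gamma> (s + t) = gmul (\<gamma> s) (\<gamma> t)) \<and> (\<gamma> has_vector_derivative A) (at 0)"

text \<open>Group exponential: value at time 1 of the one-parameter subgroup with initial velocity A.\<close>
definition gexp :: "('g::real_normed_vector \<Rightarrow> 'g \<Rightarrow> 'g) \<Rightarrow> 'g \<Rightarrow> 'g \<Rightarrow> 'g" where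
  "gexp gmul e A = (THE \<gamma>. one_param_subgroup gmul e A \<gamma>) 1"

text \<open>Left-invariant vector field with value A at e, acting on functions.\<close>
definition lvf :: "('g::real_normed_vector \<Rightarrow> 'g \<Rightarrow> 'g) \<Rightarrow> 'g \<Rightarrow> 'g \<Rightarrow> ('g \<Rightarrow> real) \<Rightarrow> 'g \<Rightarrow> real" where
  "lvf gmul e A f p = deriv (\<lambda>t. f (gmul p (gexp gmul e (t *\<^sub>R A)))) 0"

text \<open>Reeb field X0 = [X1,X2].\<close>
definition reeb :: "('g::real_normed_vector \<Rightarrow> 'g \<Rightarrow> 'g) \<Rightarrow> 'g \<Rightarrow> 'g \<Rightarrow> 'g \<Rightarrow> ('g \<Rightarrow> real) \<Rightarrow> 'g \<Rightarrow> real" where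
  "reeb gmul e A1 A2 f p = lvf gmul e A1 (lvf gmul e A2 f) p - lvf gmul e A2 (lvf gmul e A1 f) p"

text \<open>Twice continuously (Frechet) differentiable real functions on the ambient space.\<close>
definition C2 :: "('g::real_normed_vector \<Rightarrow> real) \<Rightarrow> bool" where
  "C2 f \<longleftrightarrow> (\<exists>(Df :: 'g \<Rightarrow> 'g \<Rightarrow>\<^sub>L real) (D2f :: 'g \<Rightarrow> 'g \<Rightarrow>\<^sub>L ('g \<Rightarrow>\<^sub>L real)).
      (\<forall>x. (f has_derivative blinfun_apply (Df x)) (at x)) \<and>
      (\<forall>x. (Df has_derivative blinfun_apply (D2f x)) (at x)) \<and>
      continuous_on UNIV D2f)"

section \<open>The operators \<open>\<widehat>X_S\<close>, b and \<open>\<Delta>\<^sub>0\<close> attached to S = {u = 0}\<close>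

definition hnorm :: "('g::real_normed_vector \<Rightarrow> 'g \<Rightarrow> 'g) \<Rightarrow> 'g \<Rightarrow> 'g \<Rightarrow> 'g \<Rightarrow> ('g \<Rightarrow> real) \<Rightarrow> 'g \<Rightarrow> real" where
  "hnorm gmul e A1 A2 u p = sqrt ((lvf gmul e A1 u p)\<^sup>2 + (lvf gmul e A2 u p)\<^sup>2)"

definition Xhat :: "('g::real_normed_vector \<Rightarrow> 'g \<Rightarrow> 'g) \<Rightarrow> 'g \<Rightarrow> 'g \<Rightarrow> 'g \<Rightarrow> ('g \<Rightarrow> real) \<Rightarrow> ('g \<Rightarrow> real) \<Rightarrow> 'g \<Rightarrow> real" where
  "Xhat gmul e A1 A2 u g p =
     (lvf gmul e A2 u p * lvf gmul e A1 g p - lvf gmul e A1 u p * lvf gmul e A2 g p) / hnorm gmul e A1 A2 u p"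

definition bS :: "('g::real_normed_vector \<Rightarrow> 'g \<Rightarrow> 'g) \<Rightarrow> 'g \<Rightarrow> 'g \<Rightarrow> 'g \<Rightarrow> ('g \<Rightarrow> real) \<Rightarrow> 'g \<Rightarrow> real" where
  "bS gmul e A1 A2 u p = reeb gmul e A1 A2 u p / hnorm gmul e A1 A2 u p"

definition Delta0 :: "('g::real_normed_vector \<Rightarrow> 'g \<Rightarrow> 'g) \<Rightarrow> 'g \<Rightarrow> 'g \<Rightarrow> 'g \<Rightarrow> ('g \<Rightarrow> real) \<Rightarrow> ('g \<Rightarrow> real) \<Rightarrow> 'g \<Rightarrow> real" where
  "Delta0 gmul e A1 A2 u f p =
     Xhat gmul e A1 A2 u (Xhat gmul e A1 A2 u f) p + bS gmul e A1 A2 u p * Xhat gmul e A1 A2 u f p"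

section \<open>The surface S and polar coordinates\<close>

definition Phi :: "('g::real_normed_vector \<Rightarrow> 'g \<Rightarrow> 'g) \<Rightarrow> 'g \<Rightarrow> 'g \<Rightarrow> 'g \<Rightarrow> real \<Rightarrow> real \<Rightarrow> 'g" where
  "Phi gmul e A1 A2 r \<theta> = gexp gmul e ((r * cos \<theta>) *\<^sub>R A1 + (r * sin \<theta>) *\<^sub>R A2)"

definition surfS :: "('g::real_normed_vector \<Rightarrow> 'g \<Rightarrow> 'g) \<Rightarrow> 'g \<Rightarrow> 'g \<Rightarrow> 'g \<Rightarrow> real set \<Rightarrow> 'g set" where
  "surfS gmul e A1 A2 I = {Phi gmul e A1 A2 r \<theta> | r \<theta>. r \<in> I \<and> 0 \<le> \<theta> \<and> \<theta> < 2 * pi}"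

text \<open>Admissible data at the point with polar coordinates (r,theta): u is a C2 defining
  function vanishing on S whose differential (in the frame X1,X2,X0) does not vanish there,
  f is a C2 test function, r in I, theta in [0, 2 pi).\<close>
definition admissible :: "('g::real_normed_vector \<Rightarrow> 'g \<Rightarrow> 'g) \<Rightarrow> 'g \<Rightarrow> 'g \<Rightarrow> 'g \<Rightarrow> real set
     \<Rightarrow> ('g \<Rightarrow> real) \<Rightarrow> ('g \<Rightarrow> real) \<Rightarrow> real \<Rightarrow> real \<Rightarrow> bool" where
  "admissible gmul e A1 A2 I u f r \<theta> \<longleftrightarrow>
     C2 u \<and> C2 f \<and> (\<forall>q \<in> surfS gmul e A1 A2 I. u q = 0) \<and> r \<in> I \<and> 0 \<le> \<theta> \<and> \<theta> < 2 * pi \<and>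
     (lvf gmul e A1 u (Phi gmul e A1 A2 r \<theta>), lvf gmul e A2 u (Phi gmul e A1 A2 r \<theta>),
      reeb gmul e A1 A2 u (Phi gmul e A1 A2 r \<theta>)) \<noteq> (0, 0, 0)"

text \<open>Statement: S has no characteristic points and in coordinates (r,theta)
  Delta0 = d^2/dr^2 + b(r) d/dr.\<close>
definition Delta0_polar_formula :: "('g::real_normed_vector \<Rightarrow> 'g \<Rightarrow> 'g) \<Rightarrow> 'g \<Rightarrow> 'g \<Rightarrow> 'g
     \<Rightarrow> real set \<Rightarrow> (real \<Rightarrow> real) \<Rightarrow> bool" where
  "Delta0_polar_formula gmul e A1 A2 I b \<longleftrightarrow>
     (\<forall>u f r \<theta>. admissible gmul e A1 A2 I u f r \<theta> \<longrightarrow>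
        (lvf gmul e A1 u (Phi gmul e A1 A2 r \<theta>) \<noteq> 0 \<or> lvf gmul e A2 u (Phi gmul e A1 A2 r \<theta>) \<noteq> 0) \<and>
        Delta0 gmul e A1 A2 u f (Phi gmul e A1 A2 r \<theta>) =
          deriv (deriv (\<lambda>s. f (Phi gmul e A1 A2 s \<theta>))) r
          + b r * deriv (\<lambda>s. f (Phi gmul e A1 A2 s \<theta>)) r)"

text \<open>Statement: (1/2) Delta0 acts along the leaves theta = const as the one-dimensional
  diffusion generator L (acting on functions of r).\<close>
definition half_Delta0_is_generator :: "('g::real_normed_vector \<Rightarrow> 'g \<Rightarrow> 'g) \<Rightarrow> 'g \<Rightarrow> 'g \<Rightarrow> 'g
     \<Rightarrow> real set \<Rightarrow> ((real \<Rightarrow> real) \<Rightarrow> real \<Rightarrow> real) \<Rightarrow> bool" where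
  "half_Delta0_is_generator gmul e A1 A2 I L \<longleftrightarrow>
     (\<forall>u f r \<theta>. admissible gmul e A1 A2 I u f r \<theta> \<longrightarrow>
        Delta0 gmul e A1 A2 u f (Phi gmul e A1 A2 r \<theta>) / 2 = L (\<lambda>s. f (Phi gmul e A1 A2 s \<theta>)) r)"

section \<open>Generators of the one-dimensional diffusions of order 3\<close>

definition bessel3_gen :: "(real \<Rightarrow> real) \<Rightarrow> real \<Rightarrow> real" where
  "bessel3_gen g r = deriv (deriv g) r / 2 + (1 / r) * deriv g r"

definition legendre3_gen :: "real \<Rightarrow> (real \<Rightarrow> real) \<Rightarrow> real \<Rightarrow> real" where
  "legendre3_gen k g r = deriv (deriv g) r / 2 + k * cot (k * r) * deriv g r"

definition hyp_bessel3_gen :: "real \<Rightarrow> (real \<Rightarrow> real) \<Rightarrow> real \<Rightarrow> real" where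
  "hyp_bessel3_gen k g r = deriv (deriv g) r / 2 + k * (cosh (k * r) / sinh (k * r)) * deriv g r"

section \<open>The model spaces\<close>

text \<open>Heisenberg group (kappa = 0): R^3 with the given law; X1, X2 have values
  (1,0,0), (0,1,0) at the identity (0,0,0).\<close>
definition heis_mult :: "real \<times> real \<times> real \<Rightarrow> real \<times> real \<times> real \<Rightarrow> real \<times> real \<times> real" where
  "heis_mult p q = (case p of (x1, y1, z1) \<Rightarrow> case q of (x2, y2, z2) \<Rightarrow>
      (x1 + x2, y1 + y2, z1 + z2 + (x1 * y2 - x2 * y1) / 2))"

text \<open>SU(2) (kappa = 4k^2) inside the 2x2 complex matrices; SL(2,R) (kappa = -4k^2)
  inside the 2x2 real matrices; multiplication is matrix product.\<close>
definition cmat :: "complex \<Rightarrow> complex \<Rightarrow> complex \<Rightarrow> complex \<Rightarrow> complex^2^2" where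
  "cmat a b c d = vector [vector [a, b], vector [c, d]]"

definition rmat :: "real \<Rightarrow> real \<Rightarrow> real \<Rightarrow> real \<Rightarrow> real^2^2" where
  "rmat a b c d = vector [vector [a, b], vector [c, d]]"

text \<open>Pauli matrices.\<close>
text \<open>Scalar multiple of a complex matrix.\<close>
definition cscale :: "complex \<Rightarrow> complex^2^2 \<Rightarrow> complex^2^2" where
  "cscale c M = (\<chi> i j. c * M $ i $ j)"

definition pauli1 :: "complex^2^2" where "pauli1 = cmat 0 1 1 0"
definition pauli2 :: "complex^2^2" where "pauli2 = cmat 0 (- \<i>) \<i> 0"

end

(*
  The leaf theta = const of S is the one-parameter subgroup s |-> exp (s B) of the unit horizontal
  vector B = cos theta X1 + sin theta X2, so a defining function u satisfies B u = 0 on S, i.e.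
  (X1 u, X2 u) = rho (- sin theta, cos theta).  Differentiating u (Phi (r, theta)) = 0 in theta and
  writing d Phi / d theta = alpha X1 + beta X2 + gamma X0 with gamma <> 0 gives X0 u = rho b(r) for
  b(r) = (alpha sin theta - beta cos theta) / gamma.  Hence rho <> 0 (as du <> 0), S has no
  characteristic points, Xhat_S = sgn rho d/dr and the function b of S equals sgn rho b(r).  As
  sgn rho is locally constant along the leaf, Delta0 = d^2/dr^2 + b(r) d/dr.
  On the Heisenberg group, in exponential coordinates, d Phi / d theta =
  r (- sin theta X1 + cos theta X2) - r^2/2 X0, so b(r) = 2/r.  In SU(2) and SL(2,R) the generators
  anticommute and square to lam = -k^2 resp. k^2, so exp (r B) = C r + S r B with
  (C, S) = (cos (k r), sin (k r) / k) resp. (cosh (k r), sinh (k r) / k), and b(r) = 2 C r / S r.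
*)
theory Submission
  imports Defs
begin

section \<open>Calculus\<close>

lemma has_real_derivative_along_curve:
  fixes F :: "'g::real_normed_vector \<Rightarrow> real"
  assumes "(F has_derivative F') (at (c t))" and "(c has_vector_derivative c') (at t)"
  shows "((\<lambda>t. F (c t)) has_real_derivative F' c') (at t)"
proof -
  have "((F \<circ> c) has_derivative (F' \<circ> (\<lambda>h. h *\<^sub>R c'))) (at t)"
    using diff_chain_at assms by (metis has_vector_derivative_def)
  moreover have "F' \<circ> (\<lambda>h. h *\<^sub>R c') = (*) (F' c')"
    using linear_scale[OF has_derivative_linear[OF assms(1)]] by (auto simp: fun_eq_iff)
  ultimately show ?thesis by (simp add: has_field_derivative_def comp_def)
qed

lemma has_vector_derivative_at_shift:
  assumes "((\<lambda>h. f (s + h)) has_vector_derivative D) (at 0)"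
  shows "(f has_vector_derivative D) (at s)"
proof -
  have "(((\<lambda>h. f (s + h)) \<circ> (\<lambda>x. x - s)) has_vector_derivative 1 *\<^sub>R D) (at s)"
    by (rule vector_diff_chain_at) (auto intro!: derivative_eq_intros simp: assms)
  then show ?thesis by (simp add: comp_def)
qed

lemma has_derivative_blinfun_apply_fixed:
  fixes Du :: "'g::real_normed_vector \<Rightarrow> 'g \<Rightarrow>\<^sub>L real"
  assumes "(Du has_derivative blinfun_apply D2) (at x)"
  shows "((\<lambda>y. Du y a) has_derivative (\<lambda>w. D2 w a)) (at x)"
  using blinfun.FDERIV[OF assms has_derivative_const[of a]] by simp

lemma second_difference_mean_value:
  fixes u :: "'g::real_normed_vector \<Rightarrow> real"
  assumes du: "\<And>x. (u has_derivative blinfun_apply (Du x)) (at x)"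
    and d2u: "\<And>x. (Du has_derivative blinfun_apply (D2u x)) (at x)"
    and h: "h > 0"
  obtains q where "norm (q - p) \<le> h * (norm a + norm b)"
    and "u (p + h *\<^sub>R a + h *\<^sub>R b) - u (p + h *\<^sub>R a) - u (p + h *\<^sub>R b) + u p = h\<^sup>2 * D2u q b a"
proof -
  define \<psi> where "\<psi> s = u (p + h *\<^sub>R b + s *\<^sub>R a) - u (p + s *\<^sub>R a)" for s
  have "DERIV \<psi> s :> Du (p + h *\<^sub>R b + s *\<^sub>R a) a - Du (p + s *\<^sub>R a) a" for s
    unfolding \<psi>_def
    by (intro DERIV_diff has_real_derivative_along_curve du) (auto intro!: derivative_eq_intros)
  from MVT2[OF h this] obtain \<xi> where \<xi>: "0 < \<xi>" "\<xi> < h"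
    and \<psi>_diff: "\<psi> h - \<psi> 0 = h * (Du (p + h *\<^sub>R b + \<xi> *\<^sub>R a) a - Du (p + \<xi> *\<^sub>R a) a)"
    by auto
  define \<phi> where "\<phi> t = Du (p + \<xi> *\<^sub>R a + t *\<^sub>R b) a" for t
  have "DERIV \<phi> t :> D2u (p + \<xi> *\<^sub>R a + t *\<^sub>R b) b a" for t
    unfolding \<phi>_def
    by (intro has_real_derivative_along_curve has_derivative_blinfun_apply_fixed d2u)
      (auto intro!: derivative_eq_intros)
  from MVT2[OF h this] obtain \<eta> where \<eta>: "0 < \<eta>" "\<eta> < h"
    and \<phi>_diff: "\<phi> h - \<phi> 0 = h * D2u (p + \<xi> *\<^sub>R a + \<eta> *\<^sub>R b) b a"
    by auto
  show ?thesis
  proof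
    have "norm (\<xi> *\<^sub>R a + \<eta> *\<^sub>R b) \<le> \<xi> * norm a + \<eta> * norm b"
      using \<xi> \<eta> norm_triangle_ineq[of "\<xi> *\<^sub>R a" "\<eta> *\<^sub>R b"] by simp
    also have "\<dots> \<le> h * norm a + h * norm b"
      using \<xi> \<eta> by (intro add_mono mult_right_mono) auto
    finally have "norm (\<xi> *\<^sub>R a + \<eta> *\<^sub>R b) \<le> h * norm a + h * norm b" .
    then show "norm (p + \<xi> *\<^sub>R a + \<eta> *\<^sub>R b - p) \<le> h * (norm a + norm b)"
      by (simp add: algebra_simps)
    have "\<psi> h - \<psi> 0 = h * (\<phi> h - \<phi> 0)"
      unfolding \<psi>_diff \<phi>_def by (simp add: algebra_simps)
    then show "u (p + h *\<^sub>R a + h *\<^sub>R b) - u (p + h *\<^sub>R a) - u (p + h *\<^sub>R b) + u p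
        = h\<^sup>2 * D2u (p + \<xi> *\<^sub>R a + \<eta> *\<^sub>R b) b a"
      unfolding \<phi>_diff by (simp add: \<psi>_def power2_eq_square algebra_simps)
  qed
qed

text \<open>The second difference is symmetric in \<open>a\<close> and \<open>b\<close>, and the mean value theorem writes
  it as \<open>h\<^sup>2 D2u q b a\<close> with \<open>q \<longrightarrow> p\<close> as \<open>h \<longrightarrow> 0\<close>.\<close>
lemma second_derivative_symmetric:
  fixes u :: "'g::real_normed_vector \<Rightarrow> real"
  assumes du: "\<And>x. (u has_derivative blinfun_apply (Du x)) (at x)"
    and d2u: "\<And>x. (Du has_derivative blinfun_apply (D2u x)) (at x)"
    and cont: "continuous_on UNIV D2u"
  shows "D2u p a b = D2u p b a"
proof -
  define h :: "nat \<Rightarrow> real" where "h n = inverse (real (Suc n))" for n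
  have h_pos: "h n > 0" for n by (simp add: h_def)
  have "\<exists>q1 q2. norm (q1 - p) \<le> h n * (norm a + norm b) \<and> norm (q2 - p) \<le> h n * (norm a + norm b)
      \<and> D2u q1 b a = D2u q2 a b" for n
  proof -
    obtain q1 where q1: "norm (q1 - p) \<le> h n * (norm a + norm b)"
      and "u (p + h n *\<^sub>R a + h n *\<^sub>R b) - u (p + h n *\<^sub>R a) - u (p + h n *\<^sub>R b) + u p
        = (h n)\<^sup>2 * D2u q1 b a"
      using second_difference_mean_value[OF du d2u h_pos] .
    moreover obtain q2 where q2: "norm (q2 - p) \<le> h n * (norm a + norm b)"
      and "u (p + h n *\<^sub>R b + h n *\<^sub>R a) - u (p + h n *\<^sub>R b) - u (p + h n *\<^sub>R a) + u p
        = (h n)\<^sup>2 * D2u q2 a b"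
      using second_difference_mean_value[OF du d2u h_pos, where a=b and b=a] by (auto simp: add.commute)
    ultimately have "(h n)\<^sup>2 * D2u q1 b a = (h n)\<^sup>2 * D2u q2 a b"
      by (simp add: algebra_simps)
    then show ?thesis using q1 q2 h_pos[of n] by auto
  qed
  then obtain q1 q2 where q: "\<And>n. norm (q1 n - p) \<le> h n * (norm a + norm b)"
      "\<And>n. norm (q2 n - p) \<le> h n * (norm a + norm b)" "\<And>n. D2u (q1 n) b a = D2u (q2 n) a b"
    by metis
  have h_lim: "(\<lambda>n. h n * (norm a + norm b)) \<longlonglongrightarrow> 0"
    unfolding h_def using tendsto_mult_left_zero[OF LIMSEQ_inverse_real_of_nat] by simp
  have "(\<lambda>n. q1 n - p) \<longlonglongrightarrow> 0" "(\<lambda>n. q2 n - p) \<longlonglongrightarrow> 0"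
    using q(1,2) by (auto intro: Lim_null_comparison[OF always_eventually h_lim])
  then have "q1 \<longlonglongrightarrow> p" "q2 \<longlonglongrightarrow> p"
    by (simp_all add: LIM_zero_iff)
  then have "(\<lambda>n. D2u (q1 n) b a) \<longlonglongrightarrow> D2u p b a" "(\<lambda>n. D2u (q2 n) a b) \<longlonglongrightarrow> D2u p a b"
    using cont by (auto intro!: blinfun.tendsto isCont_tendsto_compose[of _ D2u]
        simp: continuous_on_eq_continuous_at)
  then show ?thesis using q(3) LIMSEQ_unique by auto
qed

lemma has_vector_derivative_const_imp_affine:
  fixes f :: "real \<Rightarrow> 'a::real_normed_vector"
  assumes "\<And>s. (f has_vector_derivative c) (at s)"
  shows "f s = f 0 + s *\<^sub>R c"
proof -
  have "((\<lambda>s. f s - s *\<^sub>R c) has_vector_derivative c - c) (at s within UNIV)" for s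
    using assms[of s] unfolding has_vector_derivative_def
    by (auto intro!: derivative_eq_intros simp: algebra_simps)
  then obtain k where "\<And>s. f s - s *\<^sub>R c = k"
    using has_vector_derivative_zero_constant[of UNIV "\<lambda>s. f s - s *\<^sub>R c"] by auto
  from this[of s] this[of 0] show ?thesis by (simp add: algebra_simps)
qed

lemma has_vector_derivative_bounded_linear:
  assumes "bounded_linear T" "(f has_vector_derivative f') F"
  shows "((\<lambda>x. T (f x)) has_vector_derivative T f') F"
  using bounded_linear.has_derivative[OF assms(1) assms(2)[unfolded has_vector_derivative_def]]
  unfolding has_vector_derivative_def by (simp add: linear_scale[OF bounded_linear.linear[OF assms(1)]])

lemma DERIV_zero_if_vanishes_on_open:
  fixes F :: "real \<Rightarrow> real"
  assumes "open I" "s \<in> I" "\<And>x. x \<in> I \<Longrightarrow> F x = 0" "DERIV F s :> D"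
  shows "D = 0"
proof -
  have "DERIV (\<lambda>x. 0) s :> D"
    using has_field_derivative_transform_within_open[OF assms(4,1,2)] assms(3) by simp
  then show ?thesis using DERIV_const DERIV_unique by blast
qed

lemma eventually_sgn_eq:
  fixes \<rho> :: "real \<Rightarrow> real"
  assumes "isCont \<rho> r" "\<rho> r \<noteq> 0"
  shows "\<forall>\<^sub>F s in nhds r. sgn (\<rho> s) = sgn (\<rho> r)"
proof -
  have lim: "(\<rho> \<longlongrightarrow> \<rho> r) (at r)" using assms(1) by (simp add: isCont_def)
  have "\<forall>\<^sub>F s in at r. sgn (\<rho> s) = sgn (\<rho> r)"
  proof (cases "\<rho> r > 0")
    case True
    then show ?thesis using order_tendstoD(1)[OF lim, of 0] by (auto elim!: eventually_mono)
  next
    case False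
    then have "\<rho> r < 0" using assms(2) by simp
    then show ?thesis using order_tendstoD(2)[OF lim, of 0] by (auto elim!: eventually_mono)
  qed
  then show ?thesis by (simp add: eventually_nhds_conv_at)
qed

lemma unit_vector_orthogonal_decomposition:
  fixes a1 a2 c s :: real
  assumes "c\<^sup>2 + s\<^sup>2 = 1" "c * a1 + s * a2 = 0"
  shows "a1 = - (c * a2 - s * a1) * s" "a2 = (c * a2 - s * a1) * c"
proof -
  have "- (c * a2 - s * a1) * s = (c\<^sup>2 + s\<^sup>2) * a1 - c * (c * a1 + s * a2)"
    and "(c * a2 - s * a1) * c = (c\<^sup>2 + s\<^sup>2) * a2 - s * (c * a1 + s * a2)"
    by (simp_all add: algebra_simps power2_eq_square)
  then show "a1 = - (c * a2 - s * a1) * s" "a2 = (c * a2 - s * a1) * c"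
    using assms by simp_all
qed

section \<open>Left-invariant frames and the operator \<open>\<Delta>\<^sub>0\<close> on \<open>S\<close>\<close>

lemma Phi_scaleR: "Phi gmul e A1 A2 s \<theta> = gexp gmul e (s *\<^sub>R (cos \<theta> *\<^sub>R A1 + sin \<theta> *\<^sub>R A2))"
  by (simp add: Phi_def scaleR_add_right)

lemma Phi_reduced_angle:
  obtains \<theta>' where "0 \<le> \<theta>'" "\<theta>' < 2 * pi" "Phi gmul e A1 A2 s \<theta> = Phi gmul e A1 A2 s \<theta>'"
proof
  define n where "n = \<lfloor>\<theta> / (2 * pi)\<rfloor>"
  define \<theta>' where "\<theta>' = \<theta> - 2 * pi * of_int n"
  have "of_int n \<le> \<theta> / (2 * pi)" "\<theta> / (2 * pi) < of_int n + 1"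
    unfolding n_def by linarith+
  then show "0 \<le> \<theta>'" "\<theta>' < 2 * pi"
    unfolding \<theta>'_def by (auto simp: field_simps)
  have "cos \<theta>' = cos \<theta>" "sin \<theta>' = sin \<theta>"
    unfolding \<theta>'_def by (simp_all add: cos_diff sin_diff)
  then show "Phi gmul e A1 A2 s \<theta> = Phi gmul e A1 A2 s \<theta>'" by (simp add: Phi_def)
qed

lemma admissible_vanishes_on_leaves:
  assumes "admissible gmul e A1 A2 I u f r \<theta>" "s \<in> I"
  shows "u (Phi gmul e A1 A2 s \<theta>') = 0"
proof -
  obtain \<theta>'' where "0 \<le> \<theta>''" "\<theta>'' < 2 * pi" "Phi gmul e A1 A2 s \<theta>' = Phi gmul e A1 A2 s \<theta>''"
    by (rule Phi_reduced_angle)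
  then show ?thesis
    using assms unfolding admissible_def surfS_def by auto
qed

lemma C2E:
  assumes "C2 u"
  obtains Du D2u where "\<And>x. (u has_derivative blinfun_apply (Du x)) (at x)"
    "\<And>x. (Du has_derivative blinfun_apply (D2u x)) (at x)" "continuous_on UNIV D2u"
  using assms unfolding C2_def by blast

lemma
  fixes \<rho> :: real
  assumes "lvf gmul e A1 u q = - \<rho> * sin \<theta>" "lvf gmul e A2 u q = \<rho> * cos \<theta>"
  shows hnorm_polar: "hnorm gmul e A1 A2 u q = \<bar>\<rho>\<bar>"
    and Xhat_polar: "Xhat gmul e A1 A2 u g q
      = sgn \<rho> * (cos \<theta> * lvf gmul e A1 g q + sin \<theta> * lvf gmul e A2 g q)"
proof -
  have "(\<rho> * sin \<theta>)\<^sup>2 + (\<rho> * cos \<theta>)\<^sup>2 = \<rho>\<^sup>2"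
    by (simp add: power_mult_distrib flip: distrib_left)
  then show hn: "hnorm gmul e A1 A2 u q = \<bar>\<rho>\<bar>"
    using assms by (simp add: hnorm_def)
  show "Xhat gmul e A1 A2 u g q = sgn \<rho> * (cos \<theta> * lvf gmul e A1 g q + sin \<theta> * lvf gmul e A2 g q)"
    unfolding Xhat_def hn assms
    by (cases "\<rho> = 0") (simp_all add: sgn_if algebra_simps divide_simps)
qed

text \<open>\<open>V A p\<close> is the value at \<open>p\<close> of the left-invariant vector field generated by \<open>A\<close>, in the
  coordinates of the ambient space, and \<open>DV A p\<close> is its derivative at \<open>p\<close>.  The group
  exponential is only needed along the unit horizontal directions \<open>x A\<^sub>1 + y A\<^sub>2\<close>, which are
  the directions of the leaves of \<open>S\<close>.\<close>
locale left_invariant_frame =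
  fixes gmul :: "'g::real_normed_vector \<Rightarrow> 'g \<Rightarrow> 'g" and e :: 'g
    and V :: "'g \<Rightarrow> 'g \<Rightarrow> 'g" and DV :: "'g \<Rightarrow> 'g \<Rightarrow> 'g \<Rightarrow> 'g"
    and A1 A2 A0 :: 'g
  assumes flow_has_vector_derivative: "\<And>p x y. x\<^sup>2 + y\<^sup>2 = 1 \<Longrightarrow>
      ((\<lambda>t. gmul p (gexp gmul e (t *\<^sub>R (x *\<^sub>R A1 + y *\<^sub>R A2))))
        has_vector_derivative V (x *\<^sub>R A1 + y *\<^sub>R A2) p) (at 0)"
    and gmul_gexp_zero: "\<And>p. gmul p (gexp gmul e 0) = p"
    and gexp_add: "\<And>x y s t. x\<^sup>2 + y\<^sup>2 = 1 \<Longrightarrow>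
      gexp gmul e ((s + t) *\<^sub>R (x *\<^sub>R A1 + y *\<^sub>R A2)) =
        gmul (gexp gmul e (s *\<^sub>R (x *\<^sub>R A1 + y *\<^sub>R A2))) (gexp gmul e (t *\<^sub>R (x *\<^sub>R A1 + y *\<^sub>R A2)))"
    and V_linear: "\<And>p. linear (\<lambda>A. V A p)"
    and V_has_derivative: "\<And>A p. (V A has_derivative DV A p) (at p)"
    and V_bracket: "\<And>p. DV A2 p (V A1 p) - DV A1 p (V A2 p) = V A0 p"
begin

lemma lvf_unit_direction:
  assumes "(f has_derivative Df) (at p)" and "x\<^sup>2 + y\<^sup>2 = 1"
  shows "lvf gmul e (x *\<^sub>R A1 + y *\<^sub>R A2) f p = Df (V (x *\<^sub>R A1 + y *\<^sub>R A2) p)"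
  unfolding lvf_def
  by (rule DERIV_imp_deriv, rule has_real_derivative_along_curve[where c'="V _ p"])
    (use assms flow_has_vector_derivative gmul_gexp_zero in simp_all)

lemma lvf_A1: "(f has_derivative Df) (at p) \<Longrightarrow> lvf gmul e A1 f p = Df (V A1 p)"
  using lvf_unit_direction[of f Df p 1 0] by simp

lemma lvf_A2: "(f has_derivative Df) (at p) \<Longrightarrow> lvf gmul e A2 f p = Df (V A2 p)"
  using lvf_unit_direction[of f Df p 0 1] by simp

lemma lvf_frame_eq:
  fixes Du :: "'g \<Rightarrow> 'g \<Rightarrow>\<^sub>L real"
  assumes "\<And>x. (u has_derivative blinfun_apply (Du x)) (at x)"
  shows "lvf gmul e A1 u = (\<lambda>q. Du q (V A1 q))" "lvf gmul e A2 u = (\<lambda>q. Du q (V A2 q))"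
  using lvf_A1[OF assms] lvf_A2[OF assms] by auto

lemma has_derivative_frame_component:
  fixes Du :: "'g \<Rightarrow> 'g \<Rightarrow>\<^sub>L real"
  assumes "\<And>x. (Du has_derivative blinfun_apply (D2u x)) (at x)"
  shows "((\<lambda>q. Du q (V A q)) has_derivative (\<lambda>w. Du p (DV A p w) + D2u p w (V A p))) (at p)"
  using blinfun.FDERIV[OF assms V_has_derivative] by simp

lemma lvf_frame_differentiable:
  assumes "C2 u" "A \<in> {A1, A2}"
  shows "lvf gmul e A u differentiable (at p)"
proof -
  obtain Du D2u where du: "\<And>x. (u has_derivative blinfun_apply (Du x)) (at x)"
    and d2u: "\<And>x. (Du has_derivative blinfun_apply (D2u x)) (at x)"
    using C2E[OF assms(1)] by metis
  from assms(2) consider "A = A1" | "A = A2" by blast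
  then show ?thesis
    using has_derivative_frame_component[OF d2u] lvf_frame_eq[OF du]
    by cases (auto intro: differentiableI)
qed

text \<open>The symmetry of the second derivative kills the second-order terms of the commutator.\<close>
lemma reeb_eq_V0:
  assumes "C2 u"
  obtains Du :: "'g \<Rightarrow> 'g \<Rightarrow>\<^sub>L real" where "\<And>x. (u has_derivative blinfun_apply (Du x)) (at x)"
    and "reeb gmul e A1 A2 u p = Du p (V A0 p)"
proof -
  obtain Du D2u where du: "\<And>x. (u has_derivative blinfun_apply (Du x)) (at x)"
    and d2u: "\<And>x. (Du has_derivative blinfun_apply (D2u x)) (at x)"
    and cont: "continuous_on UNIV D2u"
    using C2E[OF assms] by metis
  have "reeb gmul e A1 A2 u p =
      (Du p (DV A2 p (V A1 p)) + D2u p (V A1 p) (V A2 p))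
    - (Du p (DV A1 p (V A2 p)) + D2u p (V A2 p) (V A1 p))"
    unfolding reeb_def lvf_frame_eq[OF du]
    by (simp add: lvf_A1[OF has_derivative_frame_component[OF d2u]]
        lvf_A2[OF has_derivative_frame_component[OF d2u]])
  also have "\<dots> = Du p (V A0 p)"
    using second_derivative_symmetric[OF du d2u cont, of p "V A1 p" "V A2 p"]
    by (simp add: blinfun.bilinear_simps flip: V_bracket)
  finally show ?thesis using du that by blast
qed

lemma Phi_has_vector_derivative:
  "((\<lambda>s. Phi gmul e A1 A2 s \<theta>) has_vector_derivative
      V (cos \<theta> *\<^sub>R A1 + sin \<theta> *\<^sub>R A2) (Phi gmul e A1 A2 s0 \<theta>)) (at s0)"
proof (rule has_vector_derivative_at_shift)
  have "Phi gmul e A1 A2 (s0 + t) \<theta> =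
      gmul (Phi gmul e A1 A2 s0 \<theta>) (gexp gmul e (t *\<^sub>R (cos \<theta> *\<^sub>R A1 + sin \<theta> *\<^sub>R A2)))" for t
    using gexp_add[of "cos \<theta>" "sin \<theta>" s0 t] by (simp add: Phi_scaleR)
  then show "((\<lambda>t. Phi gmul e A1 A2 (s0 + t) \<theta>) has_vector_derivative
      V (cos \<theta> *\<^sub>R A1 + sin \<theta> *\<^sub>R A2) (Phi gmul e A1 A2 s0 \<theta>)) (at 0)"
    using flow_has_vector_derivative[of "cos \<theta>" "sin \<theta>"] by simp
qed

lemma lvf_along_Phi_differentiable:
  assumes "C2 u" "A \<in> {A1, A2}"
  shows "(\<lambda>s. lvf gmul e A u (Phi gmul e A1 A2 s \<theta>)) differentiable (at r)"
proof -
  have "(\<lambda>s. Phi gmul e A1 A2 s \<theta>) differentiable (at r)"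
    using Phi_has_vector_derivative[unfolded has_vector_derivative_def] by (rule differentiableI)
  from differentiable_chain_at[OF this lvf_frame_differentiable[OF assms]] show ?thesis
    by (simp add: comp_def)
qed

lemma radial_derivative:
  assumes "(g has_derivative Dg) (at (Phi gmul e A1 A2 s \<theta>))"
  shows "((\<lambda>s. g (Phi gmul e A1 A2 s \<theta>)) has_real_derivative
      cos \<theta> * lvf gmul e A1 g (Phi gmul e A1 A2 s \<theta>) + sin \<theta> * lvf gmul e A2 g (Phi gmul e A1 A2 s \<theta>)) (at s)"
proof -
  let ?q = "Phi gmul e A1 A2 s \<theta>"
  have "Dg (V (cos \<theta> *\<^sub>R A1 + sin \<theta> *\<^sub>R A2) ?q) = cos \<theta> * Dg (V A1 ?q) + sin \<theta> * Dg (V A2 ?q)"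
    using linear_add[OF V_linear] linear_scale[OF V_linear]
      linear_add[OF has_derivative_linear[OF assms]] linear_scale[OF has_derivative_linear[OF assms]]
    by simp
  then show ?thesis
    using has_real_derivative_along_curve[OF assms Phi_has_vector_derivative]
    by (simp add: lvf_A1[OF assms] lvf_A2[OF assms])
qed

lemma radial_lvf_vanishes:
  assumes "(u has_derivative Du) (at (Phi gmul e A1 A2 s \<theta>))" "open I" "s \<in> I"
    and "\<And>s. s \<in> I \<Longrightarrow> u (Phi gmul e A1 A2 s \<theta>) = 0"
  shows "cos \<theta> * lvf gmul e A1 u (Phi gmul e A1 A2 s \<theta>) + sin \<theta> * lvf gmul e A2 u (Phi gmul e A1 A2 s \<theta>) = 0"
  by (rule DERIV_zero_if_vanishes_on_open[OF assms(2,3) assms(4) radial_derivative[OF assms(1)]])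

lemma angular_relation:
  assumes "C2 u" "\<And>\<theta>'. u (Phi gmul e A1 A2 r \<theta>') = 0"
    and "((\<lambda>\<theta>. Phi gmul e A1 A2 r \<theta>) has_vector_derivative
      \<alpha> *\<^sub>R V A1 (Phi gmul e A1 A2 r \<theta>) + \<beta> *\<^sub>R V A2 (Phi gmul e A1 A2 r \<theta>)
        + \<gamma> *\<^sub>R V A0 (Phi gmul e A1 A2 r \<theta>)) (at \<theta>)"
  shows "\<alpha> * lvf gmul e A1 u (Phi gmul e A1 A2 r \<theta>) + \<beta> * lvf gmul e A2 u (Phi gmul e A1 A2 r \<theta>)
      + \<gamma> * reeb gmul e A1 A2 u (Phi gmul e A1 A2 r \<theta>) = 0"
proof -
  let ?p = "Phi gmul e A1 A2 r \<theta>"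
  obtain Du where du: "\<And>x. (u has_derivative blinfun_apply (Du x)) (at x)"
    and reeb: "reeb gmul e A1 A2 u ?p = Du ?p (V A0 ?p)"
    using reeb_eq_V0[OF assms(1)] by metis
  have "((\<lambda>\<theta>. u (Phi gmul e A1 A2 r \<theta>)) has_real_derivative
      Du ?p (\<alpha> *\<^sub>R V A1 ?p + \<beta> *\<^sub>R V A2 ?p + \<gamma> *\<^sub>R V A0 ?p)) (at \<theta>)"
    by (rule has_real_derivative_along_curve[OF du assms(3)])
  then have "Du ?p (\<alpha> *\<^sub>R V A1 ?p + \<beta> *\<^sub>R V A2 ?p + \<gamma> *\<^sub>R V A0 ?p) = 0"
    by (rule DERIV_zero_if_vanishes_on_open[OF open_UNIV UNIV_I assms(2)])
  then show ?thesis
    by (simp add: lvf_frame_eq[OF du] reeb blinfun.bilinear_simps)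
qed

lemma Xhat_along_leaf:
  assumes "lvf gmul e A1 u (Phi gmul e A1 A2 s \<theta>) = - \<rho> * sin \<theta>"
    and "lvf gmul e A2 u (Phi gmul e A1 A2 s \<theta>) = \<rho> * cos \<theta>"
    and "(g has_derivative Dg) (at (Phi gmul e A1 A2 s \<theta>))"
  shows "Xhat gmul e A1 A2 u g (Phi gmul e A1 A2 s \<theta>) = sgn \<rho> * deriv (\<lambda>s. g (Phi gmul e A1 A2 s \<theta>)) s"
  unfolding Xhat_polar[OF assms(1,2)] DERIV_imp_deriv[OF radial_derivative[OF assms(3)]] ..

lemma Xhat_differentiable:
  assumes "C2 u" "C2 f" "hnorm gmul e A1 A2 u p \<noteq> 0"
  shows "Xhat gmul e A1 A2 u f differentiable (at p)"
proof -
  have u1: "lvf gmul e A1 u differentiable (at p)" and u2: "lvf gmul e A2 u differentiable (at p)"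
    and f1: "lvf gmul e A1 f differentiable (at p)" and f2: "lvf gmul e A2 f differentiable (at p)"
    using lvf_frame_differentiable assms(1,2) by blast+
  have "(lvf gmul e A1 u p)\<^sup>2 + (lvf gmul e A2 u p)\<^sup>2 > 0"
    using assms(3) by (simp add: hnorm_def sum_power2_gt_zero_iff)
  from DERIV_real_sqrt[OF this]
  have "sqrt differentiable (at ((lvf gmul e A1 u p)\<^sup>2 + (lvf gmul e A2 u p)\<^sup>2))"
    unfolding has_field_derivative_def by (rule differentiableI)
  moreover have "(\<lambda>q. (lvf gmul e A1 u q)\<^sup>2 + (lvf gmul e A2 u q)\<^sup>2) differentiable (at p)"
    using u1 u2 by (intro differentiable_add differentiable_power)
  ultimately have "hnorm gmul e A1 A2 u differentiable (at p)"
    using differentiable_chain_at by (fastforce simp: comp_def hnorm_def[abs_def])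
  then show ?thesis
    unfolding Xhat_def[abs_def] using assms(3) u1 u2 f1 f2
    by (intro differentiable_divide differentiable_diff differentiable_mult)
qed

text \<open>Along the leaf \<open>Xhat_S = sgn \<rho> d/dr\<close>, and \<open>sgn \<rho>\<close> is constant near \<open>r\<close>.\<close>
lemma Delta0_along_leaf:
  assumes u: "C2 u" and f: "C2 f" and I: "open I" "r \<in> I"
    and leaf: "\<And>s. s \<in> I \<Longrightarrow> lvf gmul e A1 u (Phi gmul e A1 A2 s \<theta>) = - \<rho> s * sin \<theta>
        \<and> lvf gmul e A2 u (Phi gmul e A1 A2 s \<theta>) = \<rho> s * cos \<theta>"
    and \<rho>: "isCont \<rho> r" "\<rho> r \<noteq> 0"
    and reeb: "reeb gmul e A1 A2 u (Phi gmul e A1 A2 r \<theta>) = \<rho> r * c"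
  shows "Delta0 gmul e A1 A2 u f (Phi gmul e A1 A2 r \<theta>) =
    deriv (deriv (\<lambda>s. f (Phi gmul e A1 A2 s \<theta>))) r + c * deriv (\<lambda>s. f (Phi gmul e A1 A2 s \<theta>)) r"
proof -
  define P where "P s = Phi gmul e A1 A2 s \<theta>" for s
  define F1 where "F1 = deriv (\<lambda>s. f (P s))"
  obtain Df :: "'g \<Rightarrow> 'g \<Rightarrow>\<^sub>L real" where df: "\<And>x. (f has_derivative Df x) (at x)"
    using C2E[OF f] by metis
  have F1_eq: "F1 = (\<lambda>s. cos \<theta> * lvf gmul e A1 f (P s) + sin \<theta> * lvf gmul e A2 f (P s))"
    unfolding F1_def P_def using DERIV_imp_deriv[OF radial_derivative[OF df]] by blast
  have "F1 differentiable (at r)"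
    unfolding F1_eq P_def using lvf_along_Phi_differentiable[OF f]
    by (intro differentiable_add differentiable_mult differentiable_const) auto
  then obtain F2 where F2: "DERIV F1 r :> F2"
    by (auto simp: real_differentiable_def)
  have Xf: "Xhat gmul e A1 A2 u f (P s) = sgn (\<rho> s) * F1 s" if "s \<in> I" for s
    unfolding P_def F1_def using Xhat_along_leaf leaf[OF that] df by blast
  have ev: "\<forall>\<^sub>F s in nhds r. Xhat gmul e A1 A2 u f (P s) = sgn (\<rho> r) * F1 s"
    using eventually_conj[OF eventually_nhds_in_open[OF I] eventually_sgn_eq[OF \<rho>]]
    by eventually_elim (simp add: Xf)
  have DXf: "DERIV (\<lambda>s. Xhat gmul e A1 A2 u f (P s)) r :> sgn (\<rho> r) * F2"
    by (rule DERIV_cong_ev[OF refl _ refl, THEN iffD2, OF ev DERIV_cmult[OF F2]])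
  have hn: "hnorm gmul e A1 A2 u (P r) = \<bar>\<rho> r\<bar>"
    unfolding P_def using hnorm_polar leaf[OF I(2)] by blast
  obtain DXf where "(Xhat gmul e A1 A2 u f has_derivative DXf) (at (P r))"
    using Xhat_differentiable[OF u f] hn \<rho>(2) by (fastforce simp: differentiable_def)
  then have "Xhat gmul e A1 A2 u (Xhat gmul e A1 A2 u f) (P r) = sgn (\<rho> r) * (sgn (\<rho> r) * F2)"
    unfolding P_def using Xhat_along_leaf leaf[OF I(2)] DERIV_imp_deriv[OF DXf[unfolded P_def]]
    by metis
  also have "\<dots> = F2" using \<rho>(2) by (simp add: sgn_mult_self_eq flip: mult.assoc)
  finally have XXf: "Xhat gmul e A1 A2 u (Xhat gmul e A1 A2 u f) (P r) = F2" .
  have "bS gmul e A1 A2 u (P r) = sgn (\<rho> r) * c"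
    using reeb[folded P_def] \<rho>(2) unfolding bS_def hn by (simp add: sgn_if)
  then have "Delta0 gmul e A1 A2 u f (P r) = F2 + c * F1 r"
    unfolding Delta0_def XXf Xf[OF I(2)] using \<rho>(2) by (simp add: sgn_if)
  with DERIV_imp_deriv[OF F2] show ?thesis
    unfolding F1_def P_def by simp
qed

lemma Delta0_polar_formulaI:
  assumes I: "open I"
    and angular: "\<And>r \<theta>. r \<in> I \<Longrightarrow> ((\<lambda>\<theta>. Phi gmul e A1 A2 r \<theta>) has_vector_derivative
        \<alpha> r \<theta> *\<^sub>R V A1 (Phi gmul e A1 A2 r \<theta>) + \<beta> r \<theta> *\<^sub>R V A2 (Phi gmul e A1 A2 r \<theta>)
         + \<gamma> r \<theta> *\<^sub>R V A0 (Phi gmul e A1 A2 r \<theta>)) (at \<theta>)"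
    and \<gamma>: "\<And>r \<theta>. r \<in> I \<Longrightarrow> \<gamma> r \<theta> \<noteq> 0"
    and b: "\<And>r \<theta>. r \<in> I \<Longrightarrow> (\<alpha> r \<theta> * sin \<theta> - \<beta> r \<theta> * cos \<theta>) / \<gamma> r \<theta> = b r"
  shows "Delta0_polar_formula gmul e A1 A2 I b"
  unfolding Delta0_polar_formula_def
proof (intro allI impI)
  fix u f r \<theta> assume adm: "admissible gmul e A1 A2 I u f r \<theta>"
  then have u: "C2 u" and f: "C2 f" and r: "r \<in> I"
    unfolding admissible_def by auto
  define X1u where "X1u s = lvf gmul e A1 u (Phi gmul e A1 A2 s \<theta>)" for s
  define X2u where "X2u s = lvf gmul e A2 u (Phi gmul e A1 A2 s \<theta>)" for s
  define \<rho> where "\<rho> s = cos \<theta> * X2u s - sin \<theta> * X1u s" for s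
  have leaf: "X1u s = - \<rho> s * sin \<theta> \<and> X2u s = \<rho> s * cos \<theta>" if "s \<in> I" for s
  proof -
    obtain Du :: "'g \<Rightarrow> 'g \<Rightarrow>\<^sub>L real" where "\<And>x. (u has_derivative Du x) (at x)"
      using C2E[OF u] by metis
    then have "cos \<theta> * X1u s + sin \<theta> * X2u s = 0"
      unfolding X1u_def X2u_def
      using radial_lvf_vanishes I that admissible_vanishes_on_leaves[OF adm] by blast
    then show ?thesis
      unfolding \<rho>_def using unit_vector_orthogonal_decomposition[of "cos \<theta>" "sin \<theta>"] by simp
  qed
  have "\<alpha> r \<theta> * X1u r + \<beta> r \<theta> * X2u r + \<gamma> r \<theta> * reeb gmul e A1 A2 u (Phi gmul e A1 A2 r \<theta>) = 0"
    unfolding X1u_def X2u_def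
    using angular_relation[OF u admissible_vanishes_on_leaves[OF adm r] angular[OF r]] .
  then have "\<gamma> r \<theta> * reeb gmul e A1 A2 u (Phi gmul e A1 A2 r \<theta>)
      = \<rho> r * (\<alpha> r \<theta> * sin \<theta> - \<beta> r \<theta> * cos \<theta>)"
    using leaf[OF r] by (simp add: algebra_simps)
  also have "\<dots> = \<gamma> r \<theta> * (\<rho> r * b r)"
    using \<gamma>[OF r, of \<theta>] b[OF r, of \<theta>] by (simp add: field_simps)
  finally have reeb: "reeb gmul e A1 A2 u (Phi gmul e A1 A2 r \<theta>) = \<rho> r * b r"
    using \<gamma>[OF r, of \<theta>] by simp
  have \<rho>_nonzero: "\<rho> r \<noteq> 0"
    using adm leaf[OF r] reeb unfolding admissible_def X1u_def X2u_def by auto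
  have \<rho>_cont: "isCont \<rho> r"
    unfolding \<rho>_def X1u_def X2u_def
    using lvf_along_Phi_differentiable[OF u]
    by (auto intro!: continuous_intros differentiable_imp_continuous_within)
  show "(lvf gmul e A1 u (Phi gmul e A1 A2 r \<theta>) \<noteq> 0 \<or> lvf gmul e A2 u (Phi gmul e A1 A2 r \<theta>) \<noteq> 0) \<and>
      Delta0 gmul e A1 A2 u f (Phi gmul e A1 A2 r \<theta>) =
        deriv (deriv (\<lambda>s. f (Phi gmul e A1 A2 s \<theta>))) r + b r * deriv (\<lambda>s. f (Phi gmul e A1 A2 s \<theta>)) r"
    using Delta0_along_leaf[OF u f I r leaf[unfolded X1u_def X2u_def] \<rho>_cont \<rho>_nonzero reeb]
      leaf[OF r] \<rho>_nonzero sin_zero_abs_cos_one[of \<theta>]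
    unfolding X1u_def X2u_def by auto
qed

end

lemma half_Delta0_is_generatorI:
  assumes "Delta0_polar_formula gmul e A1 A2 I b"
    and "\<And>g r. r \<in> I \<Longrightarrow> L g r = deriv (deriv g) r / 2 + (b r / 2) * deriv g r"
  shows "half_Delta0_is_generator gmul e A1 A2 I L"
  using assms unfolding half_Delta0_is_generator_def Delta0_polar_formula_def admissible_def
  by (simp add: add_divide_distrib)

section \<open>The Heisenberg group\<close>

definition heis_dL :: "real \<times> real \<times> real \<Rightarrow> real \<times> real \<times> real \<Rightarrow> real \<times> real \<times> real" where
  "heis_dL p q = (fst q, fst (snd q), snd (snd q) + (fst p * fst (snd q) - fst q * fst (snd p)) / 2)"

lemma heis_mult_eq: "heis_mult p q = p + heis_dL p q"
  by (cases p; cases q) (simp add: heis_mult_def heis_dL_def)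

lemma bounded_linear_heis_dL: "bounded_linear (heis_dL p)"
  unfolding linear_conv_bounded_linear[symmetric]
  by (rule linearI) (auto simp: heis_dL_def algebra_simps add_divide_distrib diff_divide_distrib)

lemma heis_one_param_subgroup: "one_param_subgroup heis_mult (0, 0, 0) A (\<lambda>t. t *\<^sub>R A)"
  unfolding one_param_subgroup_def
  by (cases A) (auto simp: heis_mult_def algebra_simps intro!: derivative_eq_intros)

lemma heis_one_param_subgroup_unique:
  assumes "one_param_subgroup heis_mult (0, 0, 0) A \<gamma>"
  shows "\<gamma> = (\<lambda>t. t *\<^sub>R A)"
proof -
  have \<gamma>0: "\<gamma> 0 = 0" and \<gamma>_add: "\<And>s t. \<gamma> (s + t) = heis_mult (\<gamma> s) (\<gamma> t)"
    and \<gamma>': "(\<gamma> has_vector_derivative A) (at 0)"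
    using assms unfolding one_param_subgroup_def by (auto simp: zero_prod_def)
  have D\<gamma>: "(\<gamma> has_vector_derivative heis_dL (\<gamma> s) A) (at s)" for s
  proof (rule has_vector_derivative_at_shift)
    show "((\<lambda>h. \<gamma> (s + h)) has_vector_derivative heis_dL (\<gamma> s) A) (at 0)"
      using has_vector_derivative_add[OF has_vector_derivative_const[of "\<gamma> s"]
          has_vector_derivative_bounded_linear[OF bounded_linear_heis_dL \<gamma>']]
      by (simp add: \<gamma>_add heis_mult_eq)
  qed
  have "fst (\<gamma> s) = s * fst A" for s
    using has_vector_derivative_const_imp_affine[of "\<lambda>s. fst (\<gamma> s)"]
      has_vector_derivative_bounded_linear[OF bounded_linear_fst D\<gamma>] \<gamma>0
    by (simp add: heis_dL_def)
  moreover have "fst (snd (\<gamma> s)) = s * fst (snd A)" for s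
    using has_vector_derivative_const_imp_affine[of "\<lambda>s. fst (snd (\<gamma> s))"]
      has_vector_derivative_bounded_linear[OF bounded_linear_compose[OF bounded_linear_fst bounded_linear_snd] D\<gamma>]
      \<gamma>0
    by (simp add: heis_dL_def)
  ultimately have "heis_dL (\<gamma> s) A = A" for s
    by (simp add: heis_dL_def)
  then show ?thesis
    using has_vector_derivative_const_imp_affine[of \<gamma> A] D\<gamma> \<gamma>0 by auto
qed

lemma heis_gexp: "gexp heis_mult (0, 0, 0) A = A"
  using heis_one_param_subgroup heis_one_param_subgroup_unique
  unfolding gexp_def by (metis (no_types, lifting) scaleR_one the_equality)

text \<open>The left-invariant field of \<open>A\<close> at \<open>p\<close> is \<open>heis_dL p A\<close>, which is affine in \<open>p\<close> with
  linear part \<open>w \<mapsto> heis_dL w A - A\<close>.\<close>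
lemma heis_left_invariant_frame:
  "left_invariant_frame heis_mult (0, 0, 0) (\<lambda>A p. heis_dL p A) (\<lambda>A p w. heis_dL w A - A)
     (1, 0, 0) (0, 1, 0) (0, 0, 1)"
proof (rule left_invariant_frame.intro)
  fix p :: "real \<times> real \<times> real" and x y s t :: real
  let ?A = "x *\<^sub>R (1::real, 0::real, 0::real) + y *\<^sub>R (0, 1, 0)"
  have "heis_mult p (gexp heis_mult (0, 0, 0) (t *\<^sub>R ?A)) = p + t *\<^sub>R heis_dL p ?A" for t
    by (simp add: heis_gexp heis_mult_eq heis_dL_def algebra_simps diff_divide_distrib)
  then show "((\<lambda>t. heis_mult p (gexp heis_mult (0, 0, 0) (t *\<^sub>R ?A))) has_vector_derivative heis_dL p ?A) (at 0)"
    by (auto intro!: derivative_eq_intros)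
  show "heis_mult p (gexp heis_mult (0, 0, 0) 0) = p"
    by (simp add: heis_gexp heis_mult_eq heis_dL_def zero_prod_def)
  show "gexp heis_mult (0, 0, 0) ((s + t) *\<^sub>R ?A) =
      heis_mult (gexp heis_mult (0, 0, 0) (s *\<^sub>R ?A)) (gexp heis_mult (0, 0, 0) (t *\<^sub>R ?A))"
    by (simp add: heis_gexp heis_mult_def algebra_simps)
  show "linear (\<lambda>A. heis_dL p A)"
    using bounded_linear_heis_dL by (rule bounded_linear.linear)
  show "((\<lambda>p. heis_dL p A) has_derivative (\<lambda>w. heis_dL w A - A)) (at p)" for A
    unfolding heis_dL_def
    by (cases A) (auto intro!: derivative_eq_intros simp: fun_eq_iff algebra_simps diff_divide_distrib)
  show "heis_dL (heis_dL p (1, 0, 0)) (0, 1, 0) - (0, 1, 0) - (heis_dL (heis_dL p (0, 1, 0)) (1, 0, 0) - (1, 0, 0))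
      = heis_dL p (0, 0, 1)"
    by (simp add: heis_dL_def)
qed

lemma heis_Phi: "Phi heis_mult (0, 0, 0) (1, 0, 0) (0, 1, 0) r \<theta> = (r * cos \<theta>, r * sin \<theta>, 0)"
  by (simp add: Phi_def heis_gexp)

lemma heis_Delta0_polar:
  "Delta0_polar_formula heis_mult (0, 0, 0) (1, 0, 0) (0, 1, 0) {0<..} (\<lambda>r. 2 / r)"
proof (rule left_invariant_frame.Delta0_polar_formulaI[OF heis_left_invariant_frame,
      where \<alpha>="\<lambda>r \<theta>. - r * sin \<theta>" and \<beta>="\<lambda>r \<theta>. r * cos \<theta>" and \<gamma>="\<lambda>r \<theta>. - r\<^sup>2 / 2"])
  fix r \<theta> :: real assume r: "r \<in> {0<..}"
  show "- r\<^sup>2 / 2 \<noteq> 0" using r by simp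
  have "- r * sin \<theta> * sin \<theta> - r * cos \<theta> * cos \<theta> = - r * ((sin \<theta>)\<^sup>2 + (cos \<theta>)\<^sup>2)"
    by algebra
  then have "- r * sin \<theta> * sin \<theta> - r * cos \<theta> * cos \<theta> = - r" by simp
  then show "(- r * sin \<theta> * sin \<theta> - r * cos \<theta> * cos \<theta>) / (- r\<^sup>2 / 2) = 2 / r"
    using r by (simp add: power2_eq_square)
  have "r * r * (cos \<theta> * cos \<theta>) + r * r * (sin \<theta> * sin \<theta>) = r * r"
    using sin_cos_squared_add[of \<theta>] by (simp add: power2_eq_square flip: distrib_left)
  then have "(- r * sin \<theta>) *\<^sub>R heis_dL (r * cos \<theta>, r * sin \<theta>, 0) (1, 0, 0)
      + (r * cos \<theta>) *\<^sub>R heis_dL (r * cos \<theta>, r * sin \<theta>, 0) (0, 1, 0)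
      + (- r\<^sup>2 / 2) *\<^sub>R heis_dL (r * cos \<theta>, r * sin \<theta>, 0) (0, 0, 1) = (- r * sin \<theta>, r * cos \<theta>, 0)"
    by (simp add: heis_dL_def field_simps power2_eq_square)
  moreover have "((\<lambda>\<theta>. (r * cos \<theta>, r * sin \<theta>, 0::real)) has_vector_derivative (- r * sin \<theta>, r * cos \<theta>, 0)) (at \<theta>)"
    by (intro has_vector_derivative_Pair has_vector_derivative_const)
      (auto intro!: derivative_eq_intros simp flip: has_real_derivative_iff_has_vector_derivative)
  ultimately show "((\<lambda>\<theta>. Phi heis_mult (0, 0, 0) (1, 0, 0) (0, 1, 0) r \<theta>) has_vector_derivative
      (- r * sin \<theta>) *\<^sub>R heis_dL (Phi heis_mult (0, 0, 0) (1, 0, 0) (0, 1, 0) r \<theta>) (1, 0, 0) +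
      (r * cos \<theta>) *\<^sub>R heis_dL (Phi heis_mult (0, 0, 0) (1, 0, 0) (0, 1, 0) r \<theta>) (0, 1, 0) +
      (- r\<^sup>2 / 2) *\<^sub>R heis_dL (Phi heis_mult (0, 0, 0) (1, 0, 0) (0, 1, 0) r \<theta>) (0, 0, 1)) (at \<theta>)"
    unfolding heis_Phi by simp
qed (simp add: open_greaterThan)

section \<open>Matrix groups\<close>

lemma matrix_mul_scaleR_left: "((c::real) *\<^sub>R A) ** (B :: 'a::real_algebra_1 ^ 'n ^ 'm) = c *\<^sub>R (A ** B)"
  by (simp add: matrix_matrix_mult_def vec_eq_iff scaleR_sum_right)

lemma matrix_mul_scaleR_right: "(A :: 'a::real_algebra_1 ^ 'n ^ 'm) ** ((c::real) *\<^sub>R B) = c *\<^sub>R (A ** B)"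
  by (simp add: matrix_matrix_mult_def vec_eq_iff scaleR_sum_right)

lemma matrix_add_rdistrib: "((A :: 'a::semiring_1 ^ 'n ^ 'm) + B) ** C = A ** C + B ** C"
  by (simp add: matrix_matrix_mult_def vec_eq_iff sum.distrib distrib_right)

lemma bounded_bilinear_matrix_mul:
  "bounded_bilinear ((**) :: 'a::{real_normed_field,euclidean_space} ^ 'n ^ 'n \<Rightarrow> _ \<Rightarrow> _)"
proof -
  have "bilinear ((**) :: 'a ^ 'n ^ 'n \<Rightarrow> _ \<Rightarrow> _)"
    unfolding bilinear_def
    by (auto intro!: linearI simp: matrix_add_ldistrib matrix_add_rdistrib
        matrix_mul_scaleR_left matrix_mul_scaleR_right)
  then show ?thesis by (simp add: bilinear_conv_bounded_bilinear)
qed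

lemma one_param_subgroup_matrix_has_vector_derivative:
  fixes \<gamma> :: "real \<Rightarrow> 'a::{real_normed_field,euclidean_space} ^ 'n ^ 'n"
  assumes "one_param_subgroup (**) (mat 1) A \<gamma>"
  shows "(\<gamma> has_vector_derivative \<gamma> s ** A) (at s)" "(\<gamma> has_vector_derivative A ** \<gamma> s) (at s)"
proof -
  have add: "\<And>s t. \<gamma> (s + t) = \<gamma> s ** \<gamma> t" and \<gamma>': "(\<gamma> has_vector_derivative A) (at 0)"
    using assms unfolding one_param_subgroup_def by auto
  show "(\<gamma> has_vector_derivative \<gamma> s ** A) (at s)"
    by (rule has_vector_derivative_at_shift)
      (use has_vector_derivative_bounded_linear[OF
        bounded_bilinear.bounded_linear_right[OF bounded_bilinear_matrix_mul] \<gamma>'] in \<open>simp add: add\<close>)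
  show "(\<gamma> has_vector_derivative A ** \<gamma> s) (at s)"
    by (rule has_vector_derivative_at_shift)
      (use has_vector_derivative_bounded_linear[OF
        bounded_bilinear.bounded_linear_left[OF bounded_bilinear_matrix_mul] \<gamma>', of "\<gamma> s"]
        in \<open>simp add: add[of _ s, symmetric] add.commute\<close>)
qed

text \<open>\<open>\<gamma> s ** \<eta> (- s)\<close> has derivative zero.\<close>
lemma one_param_subgroup_matrix_unique:
  fixes \<gamma> \<eta> :: "real \<Rightarrow> 'a::{real_normed_field,euclidean_space} ^ 'n ^ 'n"
  assumes \<gamma>: "one_param_subgroup (**) (mat 1) A \<gamma>" and \<eta>: "one_param_subgroup (**) (mat 1) A \<eta>"
  shows "\<gamma> = \<eta>"
proof
  fix s
  have uminus': "(uminus has_vector_derivative -1) (at t)" for t :: real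
    unfolding has_real_derivative_iff_has_vector_derivative[symmetric]
    by (auto intro!: derivative_eq_intros)
  have \<eta>_minus: "((\<lambda>s. \<eta> (- s)) has_vector_derivative - (A ** \<eta> (- t))) (at t)" for t
    using vector_diff_chain_at[OF uminus' one_param_subgroup_matrix_has_vector_derivative(2)[OF \<eta>]]
    by (simp add: comp_def)
  have "((\<lambda>s. \<gamma> s ** \<eta> (- s)) has_derivative (\<lambda>h. 0)) (at t within UNIV)" for t
    using bounded_bilinear.FDERIV[OF bounded_bilinear_matrix_mul,
        OF one_param_subgroup_matrix_has_vector_derivative(1)[OF \<gamma>, of t, unfolded has_vector_derivative_def]
          \<eta>_minus[of t, unfolded has_vector_derivative_def]]
    by (simp add: matrix_mul_scaleR_left matrix_mul_scaleR_right matrix_mul_assoc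
        bounded_bilinear.minus_right[OF bounded_bilinear_matrix_mul])
  from has_derivative_zero_constant[OF convex_UNIV this]
  obtain c where c: "\<And>s. \<gamma> s ** \<eta> (- s) = c" by blast
  have "\<gamma> 0 = mat 1" "\<eta> 0 = mat 1" and \<eta>_add: "\<And>s t. \<eta> (s + t) = \<eta> s ** \<eta> t"
    using \<gamma> \<eta> unfolding one_param_subgroup_def by auto
  then have "\<gamma> s ** \<eta> (- s) = mat 1" and "\<eta> (- s) ** \<eta> s = mat 1"
    using c[of s] c[of 0] \<eta>_add[of "- s" s] by simp_all
  then show "\<gamma> s = \<eta> s"
    by (metis matrix_mul_assoc matrix_mul_lid matrix_mul_rid)
qed

lemma gexp_matrix:
  fixes \<eta> :: "real \<Rightarrow> 'a::{real_normed_field,euclidean_space} ^ 'n ^ 'n"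
  assumes \<eta>: "one_param_subgroup (**) (mat 1) B \<eta>"
  shows "gexp (**) (mat 1) (t *\<^sub>R B) = \<eta> t"
proof -
  have "one_param_subgroup (**) (mat 1) (t *\<^sub>R B) (\<lambda>s. \<eta> (t * s))"
    using \<eta> vector_diff_chain_at[of "\<lambda>s. t * s" t 0 \<eta> B]
      has_real_derivative_iff_has_vector_derivative[THEN iffD1, OF DERIV_cmult_Id[of t 0]]
    unfolding one_param_subgroup_def by (simp add: comp_def distrib_left)
  then have "(THE \<gamma>. one_param_subgroup (**) (mat 1) (t *\<^sub>R B) \<gamma>) = (\<lambda>s. \<eta> (t * s))"
    by (metis (no_types) the_equality one_param_subgroup_matrix_unique)
  then show ?thesis unfolding gexp_def by simp
qed

locale cos_sin_pair =
  fixes lam :: real and C S :: "real \<Rightarrow> real"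
  assumes C_add: "\<And>s t. C (s + t) = C s * C t + lam * S s * S t"
    and S_add: "\<And>s t. S (s + t) = S s * C t + C s * S t"
    and C_0: "C 0 = 1" and S_0: "S 0 = 0"
    and C_deriv: "\<And>t. DERIV C t :> lam * S t" and S_deriv: "\<And>t. DERIV S t :> C t"
    and C_S_sq: "\<And>t. (C t)\<^sup>2 - lam * (S t)\<^sup>2 = 1"
begin

lemma one_param_subgroup_square_root:
  fixes B :: "'a::{real_normed_field,euclidean_space} ^ 'n ^ 'n"
  assumes B: "B ** B = lam *\<^sub>R mat 1"
  shows "one_param_subgroup (**) (mat 1) B (\<lambda>t. C t *\<^sub>R mat 1 + S t *\<^sub>R B)"
  unfolding one_param_subgroup_def
proof (intro conjI allI)
  interpret mm: bounded_bilinear "(**) :: 'a ^ 'n ^ 'n \<Rightarrow> _ \<Rightarrow> _"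
    by (rule bounded_bilinear_matrix_mul)
  show "C 0 *\<^sub>R mat 1 + S 0 *\<^sub>R B = mat 1" by (simp add: C_0 S_0)
  show "C (s + t) *\<^sub>R mat 1 + S (s + t) *\<^sub>R B = (C s *\<^sub>R mat 1 + S s *\<^sub>R B) ** (C t *\<^sub>R mat 1 + S t *\<^sub>R B)" for s t
    by (simp add: mm.add_left mm.add_right mm.scaleR_left mm.scaleR_right B C_add S_add
        scaleR_add_left scaleR_add_right mult_ac add_ac)
  have "((\<lambda>t. C t *\<^sub>R mat 1 + S t *\<^sub>R B) has_vector_derivative
      (C 0 *\<^sub>R 0 + (lam * S 0) *\<^sub>R mat 1) + (S 0 *\<^sub>R 0 + C 0 *\<^sub>R B)) (at 0)"
    by (intro has_vector_derivative_add has_vector_derivative_scaleR C_deriv S_deriv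
        has_vector_derivative_const)
  then show "((\<lambda>t. C t *\<^sub>R mat 1 + S t *\<^sub>R B) has_vector_derivative B) (at 0)"
    by (simp add: C_0 S_0)
qed

end

text \<open>Every unit horizontal direction \<open>B\<close> then squares to \<open>lam\<close>, so its one-parameter subgroup
  is \<open>C t + S t B\<close>.\<close>
locale clifford_model = cos_sin_pair +
  fixes A1 A2 :: "'a::{real_normed_field,euclidean_space} ^ 'n ^ 'n"
  assumes A1_sq: "A1 ** A1 = lam *\<^sub>R mat 1" and A2_sq: "A2 ** A2 = lam *\<^sub>R mat 1"
    and anticomm: "A2 ** A1 = - (A1 ** A2)"
begin

interpretation mm: bounded_bilinear "(**) :: 'a ^ 'n ^ 'n \<Rightarrow> _ \<Rightarrow> _"
  by (rule bounded_bilinear_matrix_mul)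

lemma horizontal_mul:
  "(x *\<^sub>R A1 + y *\<^sub>R A2) ** (x' *\<^sub>R A1 + y' *\<^sub>R A2)
    = (lam * (x * x' + y * y')) *\<^sub>R mat 1 + (x * y' - y * x') *\<^sub>R (A1 ** A2)"
  by (simp add: mm.add_left mm.add_right mm.scaleR_left mm.scaleR_right A1_sq A2_sq anticomm
      scaleR_add_left scaleR_diff_left algebra_simps)

lemma gexp_unit_direction:
  assumes "x\<^sup>2 + y\<^sup>2 = 1"
  shows "gexp (**) (mat 1) (t *\<^sub>R (x *\<^sub>R A1 + y *\<^sub>R A2))
    = C t *\<^sub>R mat 1 + S t *\<^sub>R (x *\<^sub>R A1 + y *\<^sub>R A2)"
  using assms horizontal_mul[of x y x y]
  by (intro gexp_matrix one_param_subgroup_square_root) (simp add: power2_eq_square)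

lemma left_invariant_frame:
  "left_invariant_frame (**) (mat 1) (\<lambda>A p. p ** A) (\<lambda>A p w. w ** A) A1 A2 (A1 ** A2 - A2 ** A1)"
proof (rule left_invariant_frame.intro)
  fix p :: "'a ^ 'n ^ 'n" and x y s t :: real
  assume xy: "x\<^sup>2 + y\<^sup>2 = 1"
  let ?B = "x *\<^sub>R A1 + y *\<^sub>R A2"
  have "?B ** ?B = lam *\<^sub>R mat 1"
    using horizontal_mul[of x y x y] xy by (simp add: power2_eq_square)
  then have subgroup: "one_param_subgroup (**) (mat 1) ?B (\<lambda>t. gexp (**) (mat 1) (t *\<^sub>R ?B))"
    using one_param_subgroup_square_root gexp_unit_direction[OF xy] by simp
  then show "((\<lambda>t. p ** gexp (**) (mat 1) (t *\<^sub>R ?B)) has_vector_derivative p ** ?B) (at 0)"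
    unfolding one_param_subgroup_def
    by (intro has_vector_derivative_bounded_linear[OF mm.bounded_linear_right]) simp
  show "gexp (**) (mat 1) ((s + t) *\<^sub>R ?B) = gexp (**) (mat 1) (s *\<^sub>R ?B) ** gexp (**) (mat 1) (t *\<^sub>R ?B)"
    using subgroup unfolding one_param_subgroup_def by simp
next
  show "p ** gexp (**) (mat 1) 0 = p" for p :: "'a ^ 'n ^ 'n"
    using gexp_unit_direction[of 1 0 0] by (simp add: C_0 S_0)
  show "linear (\<lambda>A. p ** A)" for p :: "'a ^ 'n ^ 'n"
    by (rule bounded_linear.linear[OF mm.bounded_linear_right])
  show "((\<lambda>p. p ** A) has_derivative (\<lambda>w. w ** A)) (at p)" for A p :: "'a ^ 'n ^ 'n"
    by (rule mm.bounded_linear_left[THEN bounded_linear_imp_has_derivative])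
  show "(p ** A1) ** A2 - (p ** A2) ** A1 = p ** (A1 ** A2 - A2 ** A1)" for p :: "'a ^ 'n ^ 'n"
    by (simp add: matrix_mul_assoc mm.diff_right)
qed

lemma Phi_eq:
  "Phi (**) (mat 1) A1 A2 r \<theta> = C r *\<^sub>R mat 1 + S r *\<^sub>R (cos \<theta> *\<^sub>R A1 + sin \<theta> *\<^sub>R A2)"
  unfolding Phi_scaleR by (rule gexp_unit_direction) simp

lemma Phi_angular_derivative:
  "((\<lambda>\<theta>. Phi (**) (mat 1) A1 A2 r \<theta>) has_vector_derivative
      S r *\<^sub>R ((- sin \<theta>) *\<^sub>R A1 + cos \<theta> *\<^sub>R A2)) (at \<theta>)"
proof -
  have "((\<lambda>\<theta>. cos \<theta> *\<^sub>R A1) has_vector_derivative (- sin \<theta>) *\<^sub>R A1) (at \<theta>)"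
    and "((\<lambda>\<theta>. sin \<theta> *\<^sub>R A2) has_vector_derivative cos \<theta> *\<^sub>R A2) (at \<theta>)"
    using has_vector_derivative_scaleR[OF DERIV_cos has_vector_derivative_const]
      has_vector_derivative_scaleR[OF DERIV_sin has_vector_derivative_const] by simp_all
  from has_vector_derivative_add[OF this]
  have "((\<lambda>\<theta>. C r *\<^sub>R mat 1 + S r *\<^sub>R (cos \<theta> *\<^sub>R A1 + sin \<theta> *\<^sub>R A2))
      has_vector_derivative 0 + S r *\<^sub>R ((- sin \<theta>) *\<^sub>R A1 + cos \<theta> *\<^sub>R A2)) (at \<theta>)"
    by (intro has_vector_derivative_add[OF has_vector_derivative_const]
        has_vector_derivative_bounded_linear[OF bounded_linear_scaleR_right])
  then show ?thesis by (simp add: Phi_eq)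
qed

lemma angular_derivative_in_frame:
  fixes r \<theta> :: real
  defines "p \<equiv> Phi (**) (mat 1) A1 A2 r \<theta>"
  shows "(- C r * S r * sin \<theta>) *\<^sub>R (p ** A1) + (C r * S r * cos \<theta>) *\<^sub>R (p ** A2)
      + (- (S r)\<^sup>2 / 2) *\<^sub>R (p ** (A1 ** A2 - A2 ** A1))
    = S r *\<^sub>R ((- sin \<theta>) *\<^sub>R A1 + cos \<theta> *\<^sub>R A2)" (is "?lhs = S r *\<^sub>R ?W")
proof -
  let ?B = "cos \<theta> *\<^sub>R A1 + sin \<theta> *\<^sub>R A2"
  have BB: "?B ** ?B = lam *\<^sub>R mat 1" and BW: "?B ** ?W = A1 ** A2"
    using horizontal_mul[of "cos \<theta>" "sin \<theta>" "cos \<theta>" "sin \<theta>"]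
      horizontal_mul[of "cos \<theta>" "sin \<theta>" "- sin \<theta>" "cos \<theta>"]
    by (simp_all add: algebra_simps flip: power2_eq_square)
  have commutator: "A1 ** A2 - A2 ** A1 = 2 *\<^sub>R (A1 ** A2)"
    unfolding anticomm by (simp add: scaleR_2)
  have "?lhs = p ** ((C r * S r) *\<^sub>R ?W - (S r)\<^sup>2 *\<^sub>R (?B ** ?W))"
    unfolding BW commutator
    by (simp add: mm.add_right mm.diff_right mm.scaleR_right scaleR_add_right algebra_simps)
  also have "\<dots> = (S r * ((C r)\<^sup>2 - lam * (S r)\<^sup>2)) *\<^sub>R ?W"
  proof -
    have "(c *\<^sub>R mat 1 + s *\<^sub>R B) ** ((c * s) *\<^sub>R W - s\<^sup>2 *\<^sub>R (B ** W))
        = (s * (c\<^sup>2 - lam * s\<^sup>2)) *\<^sub>R W"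
      if "B ** B = lam *\<^sub>R mat 1" for B W :: "'a ^ 'n ^ 'n" and c s :: real
    proof -
      have "B ** (B ** W) = lam *\<^sub>R W"
        using that by (simp add: matrix_mul_assoc mm.scaleR_left)
      then show ?thesis
        by (simp add: mm.add_left mm.diff_right mm.scaleR_left mm.scaleR_right
            scaleR_diff_left algebra_simps power2_eq_square)
    qed
    then show ?thesis unfolding p_def Phi_eq using BB by blast
  qed
  also have "\<dots> = S r *\<^sub>R ?W" by (simp add: C_S_sq)
  finally show ?thesis .
qed

lemma Delta0_polar:
  assumes "open I" and S_nonzero: "\<And>r. r \<in> I \<Longrightarrow> S r \<noteq> 0"
  shows "Delta0_polar_formula (**) (mat 1) A1 A2 I (\<lambda>r. 2 * C r / S r)"
proof (rule left_invariant_frame.Delta0_polar_formulaI[OF left_invariant_frame \<open>open I\<close>,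
      where \<alpha>="\<lambda>r \<theta>. - C r * S r * sin \<theta>" and \<beta>="\<lambda>r \<theta>. C r * S r * cos \<theta>"
      and \<gamma>="\<lambda>r \<theta>. - (S r)\<^sup>2 / 2"])
  fix r \<theta> assume r: "r \<in> I"
  show "- (S r)\<^sup>2 / 2 \<noteq> 0" using S_nonzero[OF r] by simp
  have "- C r * S r * sin \<theta> * sin \<theta> - C r * S r * cos \<theta> * cos \<theta> = - C r * S r * ((sin \<theta>)\<^sup>2 + (cos \<theta>)\<^sup>2)"
    by algebra
  then have "- C r * S r * sin \<theta> * sin \<theta> - C r * S r * cos \<theta> * cos \<theta> = - C r * S r"
    by simp
  then show "(- C r * S r * sin \<theta> * sin \<theta> - C r * S r * cos \<theta> * cos \<theta>) / (- (S r)\<^sup>2 / 2) = 2 * C r / S r"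
    using S_nonzero[OF r] by (simp add: power2_eq_square)
  show "((\<lambda>\<theta>. Phi (**) (mat 1) A1 A2 r \<theta>) has_vector_derivative
      (- C r * S r * sin \<theta>) *\<^sub>R (Phi (**) (mat 1) A1 A2 r \<theta> ** A1)
      + (C r * S r * cos \<theta>) *\<^sub>R (Phi (**) (mat 1) A1 A2 r \<theta> ** A2)
      + (- (S r)\<^sup>2 / 2) *\<^sub>R (Phi (**) (mat 1) A1 A2 r \<theta> ** (A1 ** A2 - A2 ** A1))) (at \<theta>)"
    unfolding angular_derivative_in_frame by (rule Phi_angular_derivative)
qed

end

section \<open>\<open>SU(2)\<close> and \<open>SL(2,\<real>)\<close>\<close>

lemma su2_generators:
  fixes k :: real
  defines "X1 \<equiv> cscale (k * \<i>) pauli1" and "X2 \<equiv> cscale (k * \<i>) pauli2"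
  shows "X1 ** X1 = (- k\<^sup>2) *\<^sub>R mat 1" "X2 ** X2 = (- k\<^sup>2) *\<^sub>R mat 1" "X2 ** X1 = - (X1 ** X2)"
  unfolding X1_def X2_def
  by (simp_all add: vec_eq_iff forall_2 matrix_matrix_mult_def sum_2 cscale_def pauli1_def pauli2_def
      cmat_def mat_def complex_eq_iff power2_eq_square)

lemma sl2_generators:
  fixes k :: real
  defines "X1 \<equiv> k *\<^sub>R rmat 1 0 0 (-1)" and "X2 \<equiv> k *\<^sub>R rmat 0 1 1 0"
  shows "X1 ** X1 = k\<^sup>2 *\<^sub>R mat 1" "X2 ** X2 = k\<^sup>2 *\<^sub>R mat 1" "X2 ** X1 = - (X1 ** X2)"
  unfolding X1_def X2_def
  by (simp_all add: vec_eq_iff forall_2 matrix_matrix_mult_def sum_2 rmat_def mat_def power2_eq_square)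

lemma cos_sin_pair_circular:
  assumes "k > 0"
  shows "cos_sin_pair (- k\<^sup>2) (\<lambda>t. cos (k * t)) (\<lambda>t. sin (k * t) / k)"
proof
  fix s t :: real
  show "cos (k * (s + t)) = cos (k * s) * cos (k * t) + - k\<^sup>2 * (sin (k * s) / k) * (sin (k * t) / k)"
    using cos_add[of "k * s" "k * t"] assms by (simp add: distrib_left field_simps power2_eq_square)
  show "sin (k * (s + t)) / k = sin (k * s) / k * cos (k * t) + cos (k * s) * (sin (k * t) / k)"
    using sin_add[of "k * s" "k * t"] assms by (simp add: distrib_left field_simps)
  show "DERIV (\<lambda>t. cos (k * t)) t :> - k\<^sup>2 * (sin (k * t) / k)"
    and "DERIV (\<lambda>t. sin (k * t) / k) t :> cos (k * t)"
    using assms by (auto intro!: derivative_eq_intros simp: field_simps power2_eq_square)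
  show "(cos (k * t))\<^sup>2 - - k\<^sup>2 * (sin (k * t) / k)\<^sup>2 = 1"
    using assms sin_cos_squared_add[of "k * t"] by (simp add: field_simps power2_eq_square)
qed simp_all

lemma cos_sin_pair_hyperbolic:
  assumes "k > 0"
  shows "cos_sin_pair (k\<^sup>2) (\<lambda>t. cosh (k * t)) (\<lambda>t. sinh (k * t) / k)"
proof
  fix s t :: real
  show "cosh (k * (s + t)) = cosh (k * s) * cosh (k * t) + k\<^sup>2 * (sinh (k * s) / k) * (sinh (k * t) / k)"
    using cosh_add[of "k * s" "k * t"] assms by (simp add: distrib_left field_simps power2_eq_square)
  show "sinh (k * (s + t)) / k = sinh (k * s) / k * cosh (k * t) + cosh (k * s) * (sinh (k * t) / k)"
    using sinh_add[of "k * s" "k * t"] assms by (simp add: distrib_left field_simps)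
  show "DERIV (\<lambda>t. cosh (k * t)) t :> k\<^sup>2 * (sinh (k * t) / k)"
    and "DERIV (\<lambda>t. sinh (k * t) / k) t :> cosh (k * t)"
    using assms by (auto intro!: derivative_eq_intros simp: field_simps power2_eq_square)
  show "(cosh (k * t))\<^sup>2 - k\<^sup>2 * (sinh (k * t) / k)\<^sup>2 = 1"
    using assms cosh_square_eq[of "k * t"] by (simp add: field_simps power2_eq_square)
qed simp_all

lemma su2_Delta0_polar:
  assumes k: "k > 0"
  shows "Delta0_polar_formula (**) (mat 1) (cscale (k * \<i>) pauli1) (cscale (k * \<i>) pauli2)
    {0<..<pi / k} (\<lambda>r. 2 * k * cot (k * r))"
proof -
  interpret clifford_model "- k\<^sup>2" "\<lambda>t. cos (k * t)" "\<lambda>t. sin (k * t) / k"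
      "cscale (k * \<i>) pauli1" "cscale (k * \<i>) pauli2"
    using cos_sin_pair_circular[OF k] su2_generators
    by (simp add: clifford_model_def clifford_model_axioms_def)
  have "sin (k * r) / k \<noteq> 0" if "r \<in> {0<..<pi / k}" for r
    using that k sin_gt_zero[of "k * r"] by (simp add: field_simps)
  then have "Delta0_polar_formula (**) (mat 1) (cscale (k * \<i>) pauli1) (cscale (k * \<i>) pauli2)
      {0<..<pi / k} (\<lambda>r. 2 * cos (k * r) / (sin (k * r) / k))"
    by (intro Delta0_polar) auto
  moreover have "(\<lambda>r. 2 * cos (k * r) / (sin (k * r) / k)) = (\<lambda>r. 2 * k * cot (k * r))"
    by (simp add: cot_def field_simps)
  ultimately show ?thesis by simp
qed

lemma sl2_Delta0_polar:
  assumes k: "k > 0"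
  shows "Delta0_polar_formula (**) (mat 1) (k *\<^sub>R rmat 1 0 0 (-1)) (k *\<^sub>R rmat 0 1 1 0)
    {0<..} (\<lambda>r. 2 * k * (cosh (k * r) / sinh (k * r)))"
proof -
  interpret clifford_model "k\<^sup>2" "\<lambda>t. cosh (k * t)" "\<lambda>t. sinh (k * t) / k"
      "k *\<^sub>R rmat 1 0 0 (-1)" "k *\<^sub>R rmat 0 1 1 0"
    using cos_sin_pair_hyperbolic[OF k] sl2_generators
    by (simp add: clifford_model_def clifford_model_axioms_def)
  have "Delta0_polar_formula (**) (mat 1) (k *\<^sub>R rmat 1 0 0 (-1)) (k *\<^sub>R rmat 0 1 1 0)
      {0<..} (\<lambda>r. 2 * cosh (k * r) / (sinh (k * r) / k))"
    using k by (intro Delta0_polar) auto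
  moreover have "(\<lambda>r. 2 * cosh (k * r) / (sinh (k * r) / k)) = (\<lambda>r. 2 * k * (cosh (k * r) / sinh (k * r)))"
    by (simp add: field_simps)
  ultimately show ?thesis by simp
qed

theorem theorem1p5:
  shows
   "Delta0_polar_formula heis_mult (0, 0, 0) (1, 0, 0) (0, 1, 0) {0<..} (\<lambda>r. 2 / r) \<and>
    half_Delta0_is_generator heis_mult (0, 0, 0) (1, 0, 0) (0, 1, 0) {0<..} bessel3_gen \<and>
    (\<forall>k::real. k > 0 \<longrightarrow>
       Delta0_polar_formula (**) (mat 1) (cscale (k * \<i>) pauli1) (cscale (k * \<i>) pauli2)
          {0<..<pi / k} (\<lambda>r. 2 * k * cot (k * r)) \<and>
       half_Delta0_is_generator (**) (mat 1) (cscale (k * \<i>) pauli1) (cscale (k * \<i>) pauli2)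
          {0<..<pi / k} (legendre3_gen k)) \<and>
    (\<forall>k::real. k > 0 \<longrightarrow>
       Delta0_polar_formula (**) (mat 1) (k *\<^sub>R rmat 1 0 0 (-1)) (k *\<^sub>R rmat 0 1 1 0)
          {0<..} (\<lambda>r. 2 * k * (cosh (k * r) / sinh (k * r))) \<and>
       half_Delta0_is_generator (**) (mat 1) (k *\<^sub>R rmat 1 0 0 (-1)) (k *\<^sub>R rmat 0 1 1 0)
          {0<..} (hyp_bessel3_gen k))"
proof (intro conjI allI impI)
  show "half_Delta0_is_generator heis_mult (0, 0, 0) (1, 0, 0) (0, 1, 0) {0<..} bessel3_gen"
    by (rule half_Delta0_is_generatorI[OF heis_Delta0_polar]) (simp add: bessel3_gen_def)
  fix k :: real assume k: "k > 0"
  show "half_Delta0_is_generator (**) (mat 1) (cscale (k * \<i>) pauli1) (cscale (k * \<i>) pauli2)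
      {0<..<pi / k} (legendre3_gen k)"
    by (rule half_Delta0_is_generatorI[OF su2_Delta0_polar[OF k]]) (simp add: legendre3_gen_def)
  show "half_Delta0_is_generator (**) (mat 1) (k *\<^sub>R rmat 1 0 0 (-1)) (k *\<^sub>R rmat 0 1 1 0)
      {0<..} (hyp_bessel3_gen k)"
    by (rule half_Delta0_is_generatorI[OF sl2_Delta0_polar[OF k]]) (simp add: hyp_bessel3_gen_def)
qed (use heis_Delta0_polar su2_Delta0_polar sl2_Delta0_polar in blast)+

end
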